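(* Let $n\ge 3$. Two oriented-convex and cocyclic $n$-gons of the hyperbolic plane $\mathbb{B}$ are hyperbolically equivalent if and only if they have the same length spectrum $L_1,\ldots,L_n$.
   Context: Model: the hyperbolic plane is $\mathbb{B}=\{(\xi_1,\xi_2)\in\mathbb{R}^2 : \xi_1^2+\xi_2^2<1\}$ (Cayley/Klein model), oriented as a subset of $\mathbb{R}^2$; its straight lines are the open straight chords. On $\mathbb{R}^3$ put $\langle x,y\rangle=x_0y_0-x_1y_1-x_2y_2$ and $\|x\|=\sqrt{|\langle x,x\rangle|}$; $[x,y,z]$ is the standard determinant. A point $X=(\xi_1,\xi_2)\in\mathbb{B}$ is represented by point vectors $x=(x_0,x_1,x_2)$ with $x_0>0$, $\xi_i=x_i/x_0$ (so $\langle x,x\rangle>0$). The hyperbolic distance $d$ is given by $\cosh d(X,Y)=\langle x,y\rangle/(\|x\|\,\|y\|)$. For $X\ne Y$ the left-hand (right-hand) side of the directed line from $X$ to $Y$ is the set of $Z$ with $[x,y,z]>0$ (resp. $<0$). Equivalence: a hyperbolic motion is an orientation-preserving isometry of $(\mathbb{B},d)$ onto itself. Two figures (polygons) are hyperbolically equivalent if a hyperbolic motion carries one to the other; for polygons the $k$-th vertex is carried to the $k$-th vertex, after suitable cyclic renumbering. Polygons: an $n$-gon ($n\ge3$) $Z_1\ldots Z_n$ is a list of points $Z_1,\ldots,Z_n\in\mathbb{B}$ (vertices) with $Z_k\neq Z_{k+1}$ for all $k$, indices modulo $n$; lists differing by a cyclic permutation define the same polygon. Its sidelengths are $L_k=d(Z_k,Z_{k+1})$,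 and the list $L_1,\ldots,L_n$, corresponding to the list of vertices, is its length spectrum. The polygon is oriented-convex if $[z_k,z_{k+1},z_j]>0$ for all $k\in\{1,\ldots,n\}$ and all $j\in\{1,\ldots,n\}$ different from $k,k+1$ (mod $n$). It is cocyclic if its vertices lie on a circle. Circles: a circle in $\mathbb{B}$ is the set of points whose normalized point vectors $x$ ($\langle x,x\rangle=1$, $x_0>0$) satisfy $\langle u,x\rangle=p$ for fixed $0\ne u\in\mathbb{R}^3$, $p\neq0$, of one of three types: distance circle ($\langle u,u\rangle>0$, $u_0>0$, $p>\|u\|$; equivalently the set of points at a fixed distance $R>0$ from a center $C\in\mathbb{B}$); distance line ($\langle u,u\rangle<0$; equivalently the set of points at a fixed distance $\delta>0$ from a straight line on one side of it); horocycle ($\langle u,u\rangle=0$, $u_0>0$, $p>0$). *)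

theory Defs
  imports "HOL-Analysis.Analysis"
begin

definition hyp_plane :: "(real^2) set" where
  "hyp_plane = {X. (X $ 1)\<^sup>2 + (X $ 2)\<^sup>2 < 1}"

text \<open>Coordinates \<open>x\<^sub>0, x\<^sub>1, x\<^sub>2\<close> of a vector of \<open>\<real>\<^sup>3\<close> are \<open>x $ 1, x $ 2, x $ 3\<close>.\<close>

definition mink :: "real^3 \<Rightarrow> real^3 \<Rightarrow> real" where
  "mink x y = x $ 1 * y $ 1 - x $ 2 * y $ 2 - x $ 3 * y $ 3"

definition mink_norm :: "real^3 \<Rightarrow> real" where
  "mink_norm x = sqrt \<bar>mink x x\<bar>"

definition det3 :: "real^3 \<Rightarrow> real^3 \<Rightarrow> real^3 \<Rightarrow> real" where
  "det3 x y z = det (vector [x, y, z] :: real^3^3)"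

definition represents :: "real^3 \<Rightarrow> real^2 \<Rightarrow> bool" where
  "represents x X \<longleftrightarrow> x $ 1 > 0 \<and> X $ 1 = x $ 2 / x $ 1 \<and> X $ 2 = x $ 3 / x $ 1"

text \<open>A point vector is unique up to a positive factor. We use the representative with
  \<open>x\<^sub>0 = 1\<close>; the distance and the sides of lines defined from it do not depend on this choice
  (\<open>cosh_hyp_dist\<close>, \<open>det3_point_vec_pos_iff\<close>).\<close>

definition point_vec :: "real^2 \<Rightarrow> real^3" where
  "point_vec X = vector [1, X $ 1, X $ 2]"

definition normalized_vec :: "real^2 \<Rightarrow> real^3" where
  "normalized_vec X = (1 / mink_norm (point_vec X)) *\<^sub>R point_vec X"

definition hyp_dist :: "real^2 \<Rightarrow> real^2 \<Rightarrow> real" where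
  "hyp_dist X Y = arcosh (mink (point_vec X) (point_vec Y) /
     (mink_norm (point_vec X) * mink_norm (point_vec Y)))"

text \<open>The plane is an open subset of \<open>\<real>\<^sup>2\<close> and carries its orientation, so preserving the
  orientation means having positive Jacobian determinant at every point.\<close>

definition orientation_preserving :: "(real^2 \<Rightarrow> real^2) \<Rightarrow> bool" where
  "orientation_preserving f \<longleftrightarrow>
     (\<forall>X\<in>hyp_plane. \<exists>f'. (f has_derivative f') (at X) \<and> det (matrix f') > 0)"

definition hyp_isometry :: "(real^2 \<Rightarrow> real^2) \<Rightarrow> bool" where
  "hyp_isometry f \<longleftrightarrow> f ` hyp_plane = hyp_plane \<and>
     (\<forall>X\<in>hyp_plane. \<forall>Y\<in>hyp_plane. hyp_dist (f X) (f Y) = hyp_dist X Y)"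

definition hyp_motion :: "(real^2 \<Rightarrow> real^2) \<Rightarrow> bool" where
  "hyp_motion f \<longleftrightarrow> hyp_isometry f \<and> orientation_preserving f"

text \<open>The vertices \<open>Z\<^sub>1, \<dots>, Z\<^sub>n\<close> are \<open>Z ! 0, \<dots>, Z ! (n - 1)\<close>. Lists differing by a
  cyclic permutation define the same polygon, so polygons and their length spectra are
  compared up to \<open>cyclic_eq\<close>.\<close>

definition cyclic_eq :: "'a list \<Rightarrow> 'a list \<Rightarrow> bool" where
  "cyclic_eq xs ys \<longleftrightarrow> (\<exists>m. rotate m xs = ys)"

definition polygon :: "nat \<Rightarrow> (real^2) list \<Rightarrow> bool" where
  "polygon n Z \<longleftrightarrow> n \<ge> 3 \<and> length Z = n \<and> set Z \<subseteq> hyp_plane \<and>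
     (\<forall>k<n. Z ! k \<noteq> Z ! (Suc k mod n))"

definition length_spectrum :: "(real^2) list \<Rightarrow> real list" where
  "length_spectrum Z =
     map (\<lambda>k. hyp_dist (Z ! k) (Z ! (Suc k mod length Z))) [0..<length Z]"

definition oriented_convex :: "(real^2) list \<Rightarrow> bool" where
  "oriented_convex Z \<longleftrightarrow>
     (\<forall>k<length Z. \<forall>j<length Z. j \<noteq> k \<and> j \<noteq> Suc k mod length Z \<longrightarrow>
        det3 (point_vec (Z ! k)) (point_vec (Z ! (Suc k mod length Z))) (point_vec (Z ! j)) > 0)"

definition hyp_equivalent :: "(real^2) list \<Rightarrow> (real^2) list \<Rightarrow> bool" where
  "hyp_equivalent Z W \<longleftrightarrow> (\<exists>f. hyp_motion f \<and> cyclic_eq (map f Z) W)"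

definition circle_set :: "real^3 \<Rightarrow> real \<Rightarrow> (real^2) set" where
  "circle_set u p = {X \<in> hyp_plane. mink u (normalized_vec X) = p}"

definition distance_circle :: "(real^2) set \<Rightarrow> bool" where
  "distance_circle C \<longleftrightarrow>
     (\<exists>u p. mink u u > 0 \<and> u $ 1 > 0 \<and> p > mink_norm u \<and> C = circle_set u p)"

definition distance_line :: "(real^2) set \<Rightarrow> bool" where
  "distance_line C \<longleftrightarrow> (\<exists>u p. mink u u < 0 \<and> p \<noteq> 0 \<and> C = circle_set u p)"

definition horocycle :: "(real^2) set \<Rightarrow> bool" where
  "horocycle C \<longleftrightarrow> (\<exists>u p. mink u u = 0 \<and> u $ 1 > 0 \<and> p > 0 \<and> C = circle_set u p)"

definition hyp_circle :: "(real^2) set \<Rightarrow> bool" where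
  "hyp_circle C \<longleftrightarrow> distance_circle C \<or> distance_line C \<or> horocycle C"

definition cocyclic :: "(real^2) list \<Rightarrow> bool" where
  "cocyclic Z \<longleftrightarrow> (\<exists>C. hyp_circle C \<and> set Z \<subseteq> C)"

lemma mink_point_vec: "mink (point_vec X) (point_vec Y) = 1 - X $ 1 * Y $ 1 - X $ 2 * Y $ 2"
  by (simp add: mink_def point_vec_def)

lemma represents_scale: "represents x X \<Longrightarrow> x = x $ 1 *\<^sub>R point_vec X"
  by (auto simp: represents_def point_vec_def vec_eq_iff forall_3)

lemma mink_scale: "mink (a *\<^sub>R x) (b *\<^sub>R y) = a * b * mink x y"
  by (simp add: mink_def algebra_simps)

lemma mink_norm_scale: "a > 0 \<Longrightarrow> mink_norm (a *\<^sub>R x) = a * mink_norm x"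
  by (simp add: mink_norm_def mink_scale abs_mult real_sqrt_mult)

lemma det3_scale: "det3 (a *\<^sub>R x) (b *\<^sub>R y) (c *\<^sub>R z) = a * b * c * det3 x y z"
  by (simp add: det3_def det_3 algebra_simps)

lemma det3_point_vec_pos_iff:
  assumes "represents x X" "represents y Y" "represents z Z"
  shows "det3 x y z > 0 \<longleftrightarrow> det3 (point_vec X) (point_vec Y) (point_vec Z) > 0"
proof -
  have "det3 x y z = x $ 1 * y $ 1 * z $ 1 * det3 (point_vec X) (point_vec Y) (point_vec Z)"
    by (metis assms represents_scale det3_scale)
  moreover have "x $ 1 * y $ 1 * z $ 1 > 0"
    using assms by (simp add: represents_def)
  ultimately show ?thesis
    by (metis mult_pos_pos zero_less_mult_pos)
qed

lemma mink_point_vec_ge: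
  assumes "X \<in> hyp_plane" "Y \<in> hyp_plane"
  shows "mink (point_vec X) (point_vec Y) / (mink_norm (point_vec X) * mink_norm (point_vec Y)) \<ge> 1"
    and "mink_norm (point_vec X) > 0"
proof -
  define s t where "s = mink (point_vec X) (point_vec X)" and "t = mink (point_vec Y) (point_vec Y)"
  define m where "m = mink (point_vec X) (point_vec Y)"
  have s: "s > 0" and t: "t > 0"
    using assms by (auto simp: s_def t_def mink_point_vec hyp_plane_def power2_eq_square)
  have "2 * m = s + t + (X $ 1 - Y $ 1)\<^sup>2 + (X $ 2 - Y $ 2)\<^sup>2"
    unfolding m_def s_def t_def mink_point_vec by (simp add: power2_eq_square algebra_simps)
  then have "2 * m \<ge> s + t"
    using zero_le_power2[of "X $ 1 - Y $ 1"] zero_le_power2[of "X $ 2 - Y $ 2"] by linarith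
  then have "(s + t) / 2 \<le> m"
    by simp
  with arith_geo_mean_sqrt[OF less_imp_le[OF s] less_imp_le[OF t]] have "sqrt (s * t) \<le> m"
    by (rule order_trans)
  then have "sqrt s * sqrt t \<le> m"
    by (simp add: real_sqrt_mult)
  then show "mink (point_vec X) (point_vec Y) / (mink_norm (point_vec X) * mink_norm (point_vec Y)) \<ge> 1"
    using s t unfolding mink_norm_def m_def[symmetric] s_def[symmetric] t_def[symmetric]
    by simp
  show "mink_norm (point_vec X) > 0"
    using s by (simp add: mink_norm_def s_def)
qed

lemma hyp_dist_nonneg:
  assumes "X \<in> hyp_plane" "Y \<in> hyp_plane"
  shows "hyp_dist X Y \<ge> 0"
  unfolding hyp_dist_def using mink_point_vec_ge(1)[OF assms] by (rule arcosh_nonneg_real)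

lemma cosh_hyp_dist:
  assumes "X \<in> hyp_plane" "Y \<in> hyp_plane" "represents x X" "represents y Y"
  shows "cosh (hyp_dist X Y) = mink x y / (mink_norm x * mink_norm y)"
proof -
  have pos: "x $ 1 > 0" "y $ 1 > 0"
    using assms by (auto simp: represents_def)
  have "cosh (hyp_dist X Y) =
      mink (point_vec X) (point_vec Y) / (mink_norm (point_vec X) * mink_norm (point_vec Y))"
    unfolding hyp_dist_def using mink_point_vec_ge(1)[OF assms(1,2)] by (rule cosh_arcosh_real)
  also have "\<dots> = mink x y / (mink_norm x * mink_norm y)"
  proof -
    have "mink x y = x $ 1 * y $ 1 * mink (point_vec X) (point_vec Y)"
      using assms(3,4) by (metis represents_scale mink_scale)
    moreover have "mink_norm x = x $ 1 * mink_norm (point_vec X)"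
      using assms(3) pos by (metis represents_scale mink_norm_scale)
    moreover have "mink_norm y = y $ 1 * mink_norm (point_vec Y)"
      using assms(4) pos by (metis represents_scale mink_norm_scale)
    ultimately show ?thesis
      using pos by simp
  qed
  finally show ?thesis .
qed

lemma normalized_vec:
  assumes "X \<in> hyp_plane"
  shows "represents (normalized_vec X) X" "mink (normalized_vec X) (normalized_vec X) = 1"
proof -
  have "mink_norm (point_vec X) > 0"
    using mink_point_vec_ge(2)[OF assms assms] .
  then show "represents (normalized_vec X) X"
    by (simp add: represents_def normalized_vec_def point_vec_def)
  have "mink (point_vec X) (point_vec X) > 0"
    using assms by (simp add: mink_point_vec hyp_plane_def power2_eq_square)
  then show "mink (normalized_vec X) (normalized_vec X) = 1"
    by (simp add: normalized_vec_def mink_scale mink_norm_def)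
qed

end

theory Submission
  imports Defs
begin

text \<open>
Put \<open>z\<^sub>j\<close> for the normalized vector of the vertex \<open>Z\<^sub>j\<close>. A circle of any of the three types is the
part of the hyperboloid in an affine plane \<open>\<langle>u,x\<rangle> = 1\<close>, so all three can be treated at once. Seen from
the vertex \<open>Z\<^sub>0\<close>, a vertex \<open>Z\<^sub>j\<close> is described by a ``half-angle vector'' \<open>(x\<^sub>j, y\<^sub>j)\<close>, where
\<open>y\<^sub>j = sinh (d(Z\<^sub>0, Z\<^sub>j) / 2)\<close> and \<open>x\<^sub>j\<close> is a positive multiple of \<open>[u, z\<^sub>0, z\<^sub>j] / y\<^sub>j\<close>. These vectors lie on a
conic \<open>x\<^sup>2 + \<kappa> y\<^sup>2 = 1\<close>; with \<open>U = \<langle>u,u\<rangle>\<close> the curvature is \<open>\<kappa> = U / (1 - U)\<close>, which is positive for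
distance circles, zero for horocycles and negative for distance lines. Moreover
\<open>x\<^sub>j y\<^sub>k - x\<^sub>k y\<^sub>j = \<plusminus> sinh (d(Z\<^sub>j, Z\<^sub>k) / 2)\<close>, with the sign of \<open>[z\<^sub>0, z\<^sub>j, z\<^sub>k]\<close>. On a distance circle,
\<open>x\<^sub>j\<close> is the cosine of half the central angle from \<open>Z\<^sub>0\<close> to \<open>Z\<^sub>j\<close>, and \<open>y\<^sub>j\<close> a multiple of its sine. This is
\<open>half_angle_arc_of_cocyclic\<close>.

What remains is a plane problem: an arc of half-angle vectors is determined by its sides
\<open>c\<^sub>j = x\<^sub>j y\<^sub>j\<^sub>+\<^sub>1 - x\<^sub>j\<^sub>+\<^sub>1 y\<^sub>j\<close> and the closing side \<open>y\<^sub>m\<close>. Each vector arises from its predecessor by the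
rotation of the conic with sine \<open>c\<^sub>j\<close> and cosine \<open>C\<^sub>j = \<plusminus> sqrt (1 - \<kappa> c\<^sub>j\<^sup>2)\<close>. Numbering the vertices so
that the closing side is a longest one makes all \<open>C\<^sub>j\<close> nonnegative (\<open>half_cos_nonneg\<close>), so the arc is
determined by the sides and \<open>\<kappa>\<close>. Two arcs with the same sides and \<open>\<kappa> < \<kappa>'\<close> cannot both close
(\<open>half_angle_arc_curvature_le\<close>). If \<open>x\<^sub>m \<le> 0\<close>, the flatter arc covers at least half of a distance circle; then
compare the slopes \<open>x\<^sub>j / y\<^sub>j\<close>: they are larger on the flatter arc, whereas the conics force the opposite
at the end. If \<open>x\<^sub>m > 0\<close>, compare the \<open>y\<^sub>j\<close>: on less than half a circle, or on a horocycle or distance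
line, straightening an arc increases its chord. Both comparisons are inductions along the arc by
algebraic inequalities that are uniform in the sign of \<open>\<kappa>\<close>.

So equal length spectra give equal Gram matrices of the normalized vertices. As three consecutive
vertices are linearly independent and positively oriented, there is a Lorentz transformation of positive
determinant between the two lists (\<open>lorentz_of_gram\<close>), and the projective map that it induces on the
Klein model is a motion (\<open>hyp_motion_projective_map\<close>). The converse holds because motions preserve
distances.
\<close>

section \<open>Arcs of half-angle vectors\<close>

definition cross :: "(nat \<Rightarrow> real) \<Rightarrow> (nat \<Rightarrow> real) \<Rightarrow> nat \<Rightarrow> nat \<Rightarrow> real" where
  "cross x y j k = x j * y k - x k * y j"

text \<open>The bilinear form of the conic: the cosine of the rotation from the \<open>j\<close>-th vector to the next. In the law
of cosines for the triangle over the \<open>j\<close>-th side it acts as the cosine of the angle at the base vertex; for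
\<open>\<kappa> < 0\<close> both are hyperbolic cosines up to sign.\<close>

definition half_cos :: "real \<Rightarrow> (nat \<Rightarrow> real) \<Rightarrow> (nat \<Rightarrow> real) \<Rightarrow> nat \<Rightarrow> real" where
  "half_cos \<kappa> x y j = x j * x (Suc j) + \<kappa> * y j * y (Suc j)"

text \<open>The base vertex is counted as \<open>(1, 0)\<close>. Positivity of the consecutive cross products says that the
arc runs counterclockwise, and positivity of the \<open>y j\<close> that it does not complete the half turn which,
half-angles being measured, corresponds to one full circuit.\<close>

definition half_angle_arc :: "real \<Rightarrow> nat \<Rightarrow> (nat \<Rightarrow> real) \<Rightarrow> (nat \<Rightarrow> real) \<Rightarrow> bool" where
  "half_angle_arc \<kappa> m x y \<longleftrightarrow> x 0 = 1 \<and> y 0 = 0 \<and>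
     (\<forall>j\<le>m. (x j)\<^sup>2 + \<kappa> * (y j)\<^sup>2 = 1) \<and>
     (\<forall>j. 0 < j \<and> j \<le> m \<longrightarrow> y j > 0) \<and>
     (\<forall>j<m. cross x y j (Suc j) > 0)"

text \<open>The rotation formulas of the conic, the Pythagorean identity, and the law of cosines for the triangle
formed by the base vertex and the \<open>j\<close>-th side.\<close>

lemma half_angle_step:
  assumes "half_angle_arc \<kappa> m x y" "j < m"
  shows "y (Suc j) = y j * half_cos \<kappa> x y j + x j * cross x y j (Suc j)"
    and "x (Suc j) = x j * half_cos \<kappa> x y j - \<kappa> * y j * cross x y j (Suc j)"
    and "y j = y (Suc j) * half_cos \<kappa> x y j - x (Suc j) * cross x y j (Suc j)"
    and "(half_cos \<kappa> x y j)\<^sup>2 + \<kappa> * (cross x y j (Suc j))\<^sup>2 = 1"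
    and "(cross x y j (Suc j))\<^sup>2 =
      (y j)\<^sup>2 + (y (Suc j))\<^sup>2 - 2 * y j * y (Suc j) * half_cos \<kappa> x y j"
proof -
  have "(x j)\<^sup>2 + \<kappa> * (y j)\<^sup>2 = 1" "(x (Suc j))\<^sup>2 + \<kappa> * (y (Suc j))\<^sup>2 = 1"
    using assms by (auto simp: half_angle_arc_def)
  then show "y (Suc j) = y j * half_cos \<kappa> x y j + x j * cross x y j (Suc j)"
    "x (Suc j) = x j * half_cos \<kappa> x y j - \<kappa> * y j * cross x y j (Suc j)"
    "y j = y (Suc j) * half_cos \<kappa> x y j - x (Suc j) * cross x y j (Suc j)"
    "(half_cos \<kappa> x y j)\<^sup>2 + \<kappa> * (cross x y j (Suc j))\<^sup>2 = 1"
    "(cross x y j (Suc j))\<^sup>2 =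
      (y j)\<^sup>2 + (y (Suc j))\<^sup>2 - 2 * y j * y (Suc j) * half_cos \<kappa> x y j"
    unfolding half_cos_def cross_def by algebra+
qed

text \<open>The slopes \<open>x j / y j\<close> decrease along the arc, hence so they do between vertices that are not adjacent;
the identity in the proof is this transitivity with the denominators cleared.\<close>

lemma cross_pos:
  assumes arc: "half_angle_arc \<kappa> m x y" and "j < k" "k \<le> m"
  shows "cross x y j k > 0"
  using assms(2,3)
proof (induction k)
  case (Suc k)
  have y: "0 < i \<Longrightarrow> i \<le> m \<Longrightarrow> y i > 0" for i
    using arc by (auto simp: half_angle_arc_def)
  have step: "cross x y k (Suc k) > 0"
    using arc Suc.prems by (auto simp: half_angle_arc_def)
  show ?case
  proof (cases "j = k")
    case True
    with step show ?thesis by simp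
  next
    case False
    then have jk: "j < k" using Suc.prems by simp
    have *: "y k * cross x y j (Suc k) = y (Suc k) * cross x y j k + y j * cross x y k (Suc k)"
      by (simp add: cross_def algebra_simps)
    have yj: "y j \<ge> 0"
      using arc y[of j] jk Suc.prems by (cases "j = 0") (auto simp: half_angle_arc_def)
    have "y (Suc k) * cross x y j k > 0" "y k > 0" "y j * cross x y k (Suc k) \<ge> 0"
      using y[of "Suc k"] y[of k] Suc jk yj step by auto
    with * show ?thesis
      by (smt (verit) zero_less_mult_pos)
  qed
qed simp

text \<open>A negative cosine belongs to a side that spans more than half of the circle, or passes through infinity
on a horocycle or distance line, and such a side is strictly longer than the others. The proof compares
it with the closing side in two steps, through the chord from the base vertex to the end of the side.\<close>

lemma half_cos_nonneg:
  assumes arc: "half_angle_arc \<kappa> m x y" and "m \<ge> 2" and "j < m"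
    and longest: "cross x y j (Suc j) \<le> y m"
  shows "half_cos \<kappa> x y j \<ge> 0"
proof (rule ccontr)
  assume neg: "\<not> half_cos \<kappa> x y j \<ge> 0"
  let ?C = "half_cos \<kappa> x y j" and ?c = "cross x y j (Suc j)" and ?b = "Suc j"
  have y: "0 < i \<Longrightarrow> i \<le> m \<Longrightarrow> y i > 0" for i
    using arc by (auto simp: half_angle_arc_def)
  have c: "?c > 0"
    using arc \<open>j < m\<close> by (auto simp: half_angle_arc_def)
  have yb: "y ?b > 0" and ym: "y m > 0"
    using y \<open>j < m\<close> by auto
  have ya: "y j \<ge> 0"
    using y[of j] \<open>j < m\<close> arc by (cases "j = 0") (auto simp: half_angle_arc_def)
  \<comment> \<open>The law of cosines at the base vertex: an obtuse angle faces the longest side.\<close>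
  have csq: "?c\<^sup>2 = (y j)\<^sup>2 + (y ?b)\<^sup>2 + 2 * y j * y ?b * (- ?C)"
    using half_angle_step(5)[OF arc \<open>j < m\<close>] by simp
  have "2 * y j * y ?b * (- ?C) \<ge> 0"
    using ya yb neg by (intro mult_nonneg_nonneg) auto
  with csq have ge: "?c\<^sup>2 \<ge> (y j)\<^sup>2 + (y ?b)\<^sup>2"
    by linarith
  have "?c\<^sup>2 \<le> (y m)\<^sup>2"
    using longest c by (intro power_mono) auto
  with ge have le: "(y j)\<^sup>2 + (y ?b)\<^sup>2 \<le> (y m)\<^sup>2"
    by linarith
  show False
  proof (cases "?b = m")
    case True
    then have "y j > 0" using y[of j] \<open>m \<ge> 2\<close> by auto
    then have "(y j)\<^sup>2 > 0" by simp
    with le True show False by auto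
  next
    case False
    then have bm: "?b < m" using \<open>j < m\<close> by simp
    \<comment> \<open>In the triangle of the base vertex, \<open>?b\<close> and the last vertex, the angle at the last vertex
      has cosine \<open>x ?b\<close>. It is obtuse too, so the chord to \<open>?b\<close> exceeds the closing side.\<close>
    let ?M = "cross x y ?b m"
    have M: "?M > 0" using cross_pos[OF arc bm] by simp
    have "x ?b * ?c = y ?b * ?C - y j"
      using half_angle_step(3)[OF arc \<open>j < m\<close>] by linarith
    also have "\<dots> < 0"
      using mult_pos_neg[OF yb, of ?C] neg ya by linarith
    finally have xb: "x ?b < 0"
      using c by (simp add: mult_less_0_iff)
    have "(x ?b)\<^sup>2 + \<kappa> * (y ?b)\<^sup>2 = 1" "(x m)\<^sup>2 + \<kappa> * (y m)\<^sup>2 = 1"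
      using arc bm by (auto simp: half_angle_arc_def)
    then have "(y ?b)\<^sup>2 - (y m)\<^sup>2 = ?M\<^sup>2 + 2 * y m * ?M * (- x ?b)"
      unfolding cross_def by algebra
    moreover have "?M\<^sup>2 > 0" "2 * y m * ?M * (- x ?b) > 0"
      using M ym xb by (auto intro!: mult_pos_pos simp: mult_pos_neg)
    moreover have "(y j)\<^sup>2 \<ge> 0" by simp
    ultimately show False using le by linarith
  qed
qed

lemma half_cos_antimono:
  assumes arc: "half_angle_arc \<kappa> m x y" "half_angle_arc \<kappa>' m x' y'" and "j < m"
    and same: "cross x' y' j (Suc j) = cross x y j (Suc j)"
    and nonneg: "half_cos \<kappa> x y j \<ge> 0" "half_cos \<kappa>' x' y' j \<ge> 0"
    and "\<kappa> < \<kappa>'"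
  shows "half_cos \<kappa>' x' y' j < half_cos \<kappa> x y j"
proof -
  have "(cross x y j (Suc j))\<^sup>2 > 0"
    using arc(1) \<open>j < m\<close> by (fastforce simp: half_angle_arc_def)
  then have "\<kappa> * (cross x y j (Suc j))\<^sup>2 < \<kappa>' * (cross x y j (Suc j))\<^sup>2"
    using \<open>\<kappa> < \<kappa>'\<close> by (simp add: mult_strict_right_mono)
  then have "(half_cos \<kappa>' x' y' j)\<^sup>2 < (half_cos \<kappa> x y j)\<^sup>2"
    using half_angle_step(4)[OF arc(1) \<open>j < m\<close>] half_angle_step(4)[OF arc(2) \<open>j < m\<close>] same
    by simp
  then show ?thesis
    using nonneg by (simp add: power_less_imp_less_base)
qed

text \<open>With the slopes \<open>r = a / b\<close> and \<open>\<rho> = C / c\<close> the addition theorem of the cotangent reads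
\<open>r_next = \<rho> - 1 / (c\<^sup>2 (\<rho> + r))\<close>. The curvature has dropped out because \<open>\<rho>\<^sup>2 + \<kappa> = 1 / c\<^sup>2\<close>, and the
right-hand side increases with \<open>r\<close> and \<open>\<rho>\<close> as long as \<open>\<rho> + r > 0\<close>.\<close>

lemma slope_step_mono:
  fixes a b a' b' :: real
  assumes pos: "b > 0" "b' > 0" "c > 0"
    and nexts: "b * C + a * c > 0" "b' * C' + a' * c > 0"
    and sq: "C\<^sup>2 + \<kappa> * c\<^sup>2 = 1" "C'\<^sup>2 + \<kappa>' * c\<^sup>2 = 1"
    and "C' < C" and slope: "a' * b < a * b'"
  shows "(a' * C' - \<kappa>' * b' * c) * (b * C + a * c) < (a * C - \<kappa> * b * c) * (b' * C' + a' * c)"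
proof -
  let ?q = "b * C + a * c" and ?q' = "b' * C' + a' * c"
  have "a * C - \<kappa> * b * c = (C * ?q - b) / c" "a' * C' - \<kappa>' * b' * c = (C' * ?q' - b') / c"
    using pos(3) sq by (simp_all add: field_simps power2_eq_square) algebra+
  moreover have "(C' * ?q' - b') * ?q < (C * ?q - b) * ?q'"
  proof -
    have "C' * (?q' * ?q) < C * (?q' * ?q)"
      using nexts \<open>C' < C\<close> by simp
    moreover have "b' * ?q > b * ?q'"
    proof -
      have "b' * ?q - b * ?q' = b * b' * (C - C') + c * (a * b' - a' * b)"
        by (simp add: algebra_simps)
      moreover have "b * b' * (C - C') > 0" "c * (a * b' - a' * b) > 0"
        using pos \<open>C' < C\<close> slope by auto
      ultimately show ?thesis by linarith
    qed
    ultimately show ?thesis by (simp add: algebra_simps)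
  qed
  ultimately show ?thesis
    using pos(3) by (simp add: divide_strict_right_mono)
qed

text \<open>Here \<open>(a, b)\<close> and \<open>(a', b')\<close> stand for \<open>(x j, y j)\<close>. On an arc of less than half a circle the chord grows with the arc, and a smaller curvature makes the next
chord longer still. If \<open>a' > a\<close>, the loss in the second summand is controlled by the conics, which bound
\<open>(a' - a) (a + a')\<close> by \<open>\<kappa> (b - b') (b + b')\<close>, and by the condition that the next vertex still lies in
the half circle.\<close>

lemma height_step_mono:
  fixes a b a' b' :: real
  assumes "b' > 0" "b' \<le> b" "a > 0" "c > 0" "C \<ge> 0" "C' < C"
    and conic: "a\<^sup>2 + \<kappa> * b\<^sup>2 = 1" "a'\<^sup>2 + \<kappa>' * b'\<^sup>2 = 1"
    and "\<kappa> < \<kappa>'" and next_nonneg: "a * C - \<kappa> * b * c \<ge> 0"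
  shows "b' * C' + a' * c < b * C + a * c"
proof -
  have "b' * C' < b' * C"
    using assms by simp
  moreover have "b' * C + a' * c \<le> b * C + a * c"
  proof (cases "a' \<le> a")
    case True
    have "b' * C \<le> b * C" "a' * c \<le> a * c"
      using True assms by (auto intro: mult_right_mono)
    then show ?thesis by linarith
  next
    case False
    have "\<kappa> * b'\<^sup>2 \<le> \<kappa>' * b'\<^sup>2"
      using \<open>\<kappa> < \<kappa>'\<close> by (simp add: mult_right_mono)
    then have sq: "(a' - a) * (a + a') \<le> \<kappa> * ((b - b') * (b + b'))"
      using conic by (simp add: algebra_simps power2_eq_square)
    have pos: "(a' - a) * (a + a') > 0"
      using False \<open>a > 0\<close> by simp
    have "(b - b') * (b + b') \<ge> 0"
      using assms by simp
    then have k: "\<kappa> > 0"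
      using sq pos by (smt (verit) mult_nonpos_nonneg)
    have "(a' - a) * c * (a + a') \<le> \<kappa> * ((b - b') * (b + b')) * c"
      using mult_right_mono[OF sq, of c] \<open>c > 0\<close> by (simp add: mult.commute mult.left_commute)
    also have "\<dots> = (b - b') * (\<kappa> * b * c + \<kappa> * b' * c)"
      by (simp add: algebra_simps)
    also have "\<dots> \<le> (b - b') * (C * a + C * a')"
    proof (intro mult_left_mono add_mono)
      show 1: "\<kappa> * b * c \<le> C * a"
        using next_nonneg by (simp add: mult.commute)
      have "\<kappa> * b' * c \<le> \<kappa> * b * c"
        using k assms by (simp add: mult_left_mono mult_right_mono)
      also note 1
      also have "C * a \<le> C * a'"
        using False \<open>C \<ge> 0\<close> by (simp add: mult_left_mono)
      finally show "\<kappa> * b' * c \<le> C * a'" .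
    qed (use assms in auto)
    also have "\<dots> = (b - b') * C * (a + a')"
      by (simp add: algebra_simps)
    finally have "(a' - a) * c \<le> (b - b') * C"
      using False \<open>a > 0\<close> by simp
    then show ?thesis by (simp add: algebra_simps)
  qed
  ultimately show ?thesis by linarith
qed

text \<open>The comparison of two closed arcs with the same sides. The primed arc is taken to be the more curved one,
and the two cases are those of an unprimed arc that covers at least half of its circle or less.\<close>

lemma half_angle_arc_curvature_le:
  assumes arc: "half_angle_arc \<kappa> m x y" "half_angle_arc \<kappa>' m x' y'" and "m \<ge> 2"
    and same: "\<And>j. j < m \<Longrightarrow> cross x' y' j (Suc j) = cross x y j (Suc j)" "y' m = y m"
    and longest: "\<And>j. j < m \<Longrightarrow> cross x y j (Suc j) \<le> y m"
  shows "\<kappa>' \<le> \<kappa>"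
proof (rule ccontr)
  assume "\<not> \<kappa>' \<le> \<kappa>"
  then have less: "\<kappa> < \<kappa>'" by simp
  define c C C' where "c j = cross x y j (Suc j)" and "C j = half_cos \<kappa> x y j"
    and "C' j = half_cos \<kappa>' x' y' j" for j
  have y: "0 < i \<Longrightarrow> i \<le> m \<Longrightarrow> y i > 0" and y': "0 < i \<Longrightarrow> i \<le> m \<Longrightarrow> y' i > 0" for i
    using arc by (auto simp: half_angle_arc_def)
  have conic: "j \<le> m \<Longrightarrow> (x j)\<^sup>2 + \<kappa> * (y j)\<^sup>2 = 1" "j \<le> m \<Longrightarrow> (x' j)\<^sup>2 + \<kappa>' * (y' j)\<^sup>2 = 1" for j
    using arc by (auto simp: half_angle_arc_def)
  have start: "x 0 = 1" "y 0 = 0" "x' 0 = 1" "y' 0 = 0"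
    using arc by (auto simp: half_angle_arc_def)
  have c: "j < m \<Longrightarrow> c j > 0" for j
    using arc(1) by (auto simp: half_angle_arc_def c_def)
  have C: "j < m \<Longrightarrow> C j \<ge> 0" for j
    using half_cos_nonneg[OF arc(1) \<open>m \<ge> 2\<close>] longest by (auto simp: C_def)
  have CC': "j < m \<Longrightarrow> C' j < C j" for j
    using half_cos_antimono[OF arc] half_cos_nonneg[OF arc(2) \<open>m \<ge> 2\<close>] C same longest less
    by (auto simp: C_def C'_def)
  have step: "y (Suc j) = y j * C j + x j * c j" "x (Suc j) = x j * C j - \<kappa> * y j * c j"
    "y' (Suc j) = y' j * C' j + x' j * c j" "x' (Suc j) = x' j * C' j - \<kappa>' * y' j * c j"
    "(C j)\<^sup>2 + \<kappa> * (c j)\<^sup>2 = 1" "(C' j)\<^sup>2 + \<kappa>' * (c j)\<^sup>2 = 1" if "j < m" for j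
    using half_angle_step(1,2,4)[OF arc(1) that] half_angle_step(1,2,4)[OF arc(2) that] same(1)[OF that]
    by (auto simp: c_def C_def C'_def)
  show False
  proof (cases "x m \<le> 0")
    case True
    have slope: "Suc j \<le> m \<Longrightarrow> x' (Suc j) * y (Suc j) < x (Suc j) * y' (Suc j)" for j
    proof (induction j)
      case 0
      then show ?case using step[of 0] start c[of 0] CC'[of 0] by simp
    next
      case (Suc j)
      let ?j = "Suc j"
      have j: "?j < m" using Suc.prems by simp
      show ?case
        unfolding step(1-4)[OF j]
        using Suc j step[OF j] y[of ?j] y'[of ?j] y[of "Suc ?j"] y'[of "Suc ?j"] c CC'
        by (intro slope_step_mono) auto
    qed
    \<comment> \<open>As \<open>y' m = y m\<close>, the slopes compare the nonpositive \<open>x' m\<close> and \<open>x m\<close>, but on the conics the larger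
      curvature belongs to the smaller square.\<close>
    have "x' m * y m < x m * y m"
      using slope[of "m - 1"] \<open>m \<ge> 2\<close> same(2) by simp
    then have "x' m < x m"
      using y[of m] \<open>m \<ge> 2\<close> by simp
    then have "(x m)\<^sup>2 < (x' m)\<^sup>2"
      using True power_strict_mono[of "- x m" "- x' m" 2] by simp
    moreover have "\<kappa> * (y m)\<^sup>2 < \<kappa>' * (y m)\<^sup>2"
      using less y[of m] \<open>m \<ge> 2\<close> by simp
    ultimately show False
      using conic[of m] same(2) by simp
  next
    case False
    have x: "x j > 0" if "j \<le> m" for j
    proof (cases "j = m")
      case False
      then have "cross x y j m > 0" using cross_pos[OF arc(1)] that by simp
      moreover have "y j \<ge> 0" using y[of j] start that by (cases "j = 0") auto
      then have "x m * y j \<ge> 0" using \<open>\<not> x m \<le> 0\<close> by simp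
      ultimately have "x j * y m > 0" by (simp add: cross_def)
      then show ?thesis using y[of m] \<open>m \<ge> 2\<close> by (simp add: zero_less_mult_iff)
    qed (use False in simp)
    have height: "y' (Suc (Suc j)) < y (Suc (Suc j))" if "y' (Suc j) \<le> y (Suc j)" "Suc (Suc j) \<le> m" for j
    proof -
      let ?j = "Suc j"
      have j: "?j < m" using that by simp
      show ?thesis
        unfolding step(1,3)[OF j]
      proof (rule height_step_mono)
        show "x ?j * C ?j - \<kappa> * y ?j * c ?j \<ge> 0"
          using step(2)[OF j] x[of "Suc ?j"] that by simp
      qed (use that j y' x c C CC' conic less in auto)
    qed
    have le: "Suc j \<le> m \<Longrightarrow> y' (Suc j) \<le> y (Suc j)" for j
    proof (induction j)
      case 0
      then show ?case using step[of 0] start by simp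
    next
      case (Suc j)
      then show ?case using height[of j] by simp
    qed
    obtain i where "m = Suc (Suc i)"
      using \<open>m \<ge> 2\<close> by (auto dest!: le_Suc_ex)
    then show False
      using height[of i] le[of i] same(2) by simp
  qed
qed

text \<open>Once the curvatures agree, the rotations agree as well: their cosines are the nonnegative roots of
\<open>1 - \<kappa> c\<^sub>j\<^sup>2\<close>.\<close>

lemma half_angle_arc_unique:
  assumes arc: "half_angle_arc \<kappa> m x y" "half_angle_arc \<kappa>' m x' y'" and "m \<ge> 2"
    and same: "\<And>j. j < m \<Longrightarrow> cross x' y' j (Suc j) = cross x y j (Suc j)" "y' m = y m"
    and longest: "\<And>j. j < m \<Longrightarrow> cross x y j (Suc j) \<le> y m"
    and "j \<le> m"
  shows "x' j = x j \<and> y' j = y j"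
proof -
  have "\<kappa>' \<le> \<kappa>" "\<kappa> \<le> \<kappa>'"
    using half_angle_arc_curvature_le[OF arc \<open>m \<ge> 2\<close>]
      half_angle_arc_curvature_le[OF arc(2,1) \<open>m \<ge> 2\<close>] same longest by auto
  then have k: "\<kappa>' = \<kappa>" by simp
  show ?thesis
    using \<open>j \<le> m\<close>
  proof (induction j)
    case 0
    then show ?case using arc by (simp add: half_angle_arc_def)
  next
    case (Suc j)
    then have j: "j < m" by simp
    have "(half_cos \<kappa> x' y' j)\<^sup>2 = (half_cos \<kappa> x y j)\<^sup>2"
      using half_angle_step(4)[OF arc(1) j] half_angle_step(4)[OF arc(2) j] same(1)[OF j] k
      by simp
    moreover have "half_cos \<kappa> x y j \<ge> 0" "half_cos \<kappa> x' y' j \<ge> 0"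
      using half_cos_nonneg[OF arc(1) \<open>m \<ge> 2\<close> j] half_cos_nonneg[OF arc(2) \<open>m \<ge> 2\<close> j]
        same(1)[OF j] same(2) longest[OF j] k by auto
    ultimately have "half_cos \<kappa> x' y' j = half_cos \<kappa> x y j"
      by (simp add: power2_eq_iff_nonneg)
    then show ?case
      using half_angle_step(1,2)[OF arc(1) j] half_angle_step(1,2)[OF arc(2) j] same(1)[OF j] k Suc
      by simp
  qed
qed

section \<open>The Lorentz form\<close>

lemma det3_expand:
  "det3 x y z = x $ 1 * (y $ 2 * z $ 3 - y $ 3 * z $ 2) - x $ 2 * (y $ 1 * z $ 3 - y $ 3 * z $ 1)
    + x $ 3 * (y $ 1 * z $ 2 - y $ 2 * z $ 1)"
  by (simp add: det3_def det_3 algebra_simps)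

lemma mink_commute: "mink x y = mink y x"
  by (simp add: mink_def)

text \<open>The product of two determinants is the determinant of the matrix of Lorentz products, since the form
has determinant \<open>+1\<close>. This turns all oriented quantities below into expressions in distances.\<close>

lemma det3_mult_det3:
  "det3 a b c * det3 u v w =
     mink a u * (mink b v * mink c w - mink b w * mink c v)
   - mink a v * (mink b u * mink c w - mink b w * mink c u)
   + mink a w * (mink b u * mink c v - mink b v * mink c u)"
  unfolding det3_expand mink_def by algebra

text \<open>Cauchy-Schwarz for the spatial parts, each of which is shorter than the time component.\<close>

lemma timelike_space_part_less:
  assumes "mink x x > 0" "mink y y > 0"
  shows "\<bar>x $ 2 * y $ 2 + x $ 3 * y $ 3\<bar> < \<bar>x $ 1 * y $ 1\<bar>"
proof -
  let ?s = "x $ 2 * y $ 2 + x $ 3 * y $ 3"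
  have x2: "(x $ 2)\<^sup>2 + (x $ 3)\<^sup>2 < (x $ 1)\<^sup>2" and y2: "(y $ 2)\<^sup>2 + (y $ 3)\<^sup>2 < (y $ 1)\<^sup>2"
    using assms by (auto simp: mink_def power2_eq_square)
  have "?s\<^sup>2 + (x $ 2 * y $ 3 - x $ 3 * y $ 2)\<^sup>2 = ((x $ 2)\<^sup>2 + (x $ 3)\<^sup>2) * ((y $ 2)\<^sup>2 + (y $ 3)\<^sup>2)"
    by algebra
  then have "?s\<^sup>2 \<le> ((x $ 2)\<^sup>2 + (x $ 3)\<^sup>2) * ((y $ 2)\<^sup>2 + (y $ 3)\<^sup>2)"
    using zero_le_power2[of "x $ 2 * y $ 3 - x $ 3 * y $ 2"] by linarith
  also have "\<dots> < (x $ 1)\<^sup>2 * (y $ 1)\<^sup>2"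
    using x2 y2 by (intro mult_strict_mono') auto
  also have "\<dots> = (x $ 1 * y $ 1)\<^sup>2"
    by (simp add: power_mult_distrib)
  finally show ?thesis
    by (metis abs_ge_zero power2_abs power_less_imp_less_base)
qed

lemma timelike_mink_pos_iff:
  assumes "mink x x > 0" "x $ 1 > 0" "mink y y > 0"
  shows "mink x y > 0 \<longleftrightarrow> y $ 1 > 0"
proof -
  have "mink x y > 0 \<longleftrightarrow> x $ 1 * y $ 1 > 0"
    using timelike_space_part_less[OF assms(1,3)] unfolding mink_def by linarith
  then show ?thesis
    using assms(2) by (simp add: zero_less_mult_iff)
qed

text \<open>Lagrange's identity writes \<open>(x $ 1 * y $ 1)\<^sup>2\<close> as the square of \<open>1 + s\<close>, with \<open>s\<close> the product of the spatial
parts, plus squares that all vanish only if the spatial parts agree.\<close>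

lemma mink_unit_gt_1:
  assumes "mink x x = 1" "x $ 1 > 0" "mink y y = 1" "y $ 1 > 0" "x \<noteq> y"
  shows "mink x y > 1"
proof (rule ccontr)
  assume n: "\<not> mink x y > 1"
  let ?s = "x $ 2 * y $ 2 + x $ 3 * y $ 3"
  have "(x $ 1 * y $ 1)\<^sup>2 = (1 + ?s)\<^sup>2 + (x $ 2 - y $ 2)\<^sup>2 + (x $ 3 - y $ 3)\<^sup>2
      + (x $ 2 * y $ 3 - x $ 3 * y $ 2)\<^sup>2"
    using assms(1,3) unfolding mink_def by algebra
  moreover have "(x $ 1 * y $ 1)\<^sup>2 \<le> (1 + ?s)\<^sup>2"
    using n assms by (intro power_mono) (auto simp: mink_def)
  ultimately have "(x $ 2 - y $ 2)\<^sup>2 + (x $ 3 - y $ 3)\<^sup>2 \<le> 0"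
    using zero_le_power2[of "x $ 2 * y $ 3 - x $ 3 * y $ 2"] by linarith
  then have "(x $ 2 - y $ 2)\<^sup>2 + (x $ 3 - y $ 3)\<^sup>2 = 0"
    using sum_power2_ge_zero[of "x $ 2 - y $ 2" "x $ 3 - y $ 3"] by linarith
  then have e: "x $ 2 = y $ 2" "x $ 3 = y $ 3"
    by (auto simp: sum_power2_eq_zero_iff)
  then have "(x $ 1)\<^sup>2 = (y $ 1)\<^sup>2"
    using assms(1,3) by (simp add: mink_def power2_eq_square)
  then have "x $ 1 = y $ 1"
    using assms by (simp add: power2_eq_iff_nonneg)
  with e assms(5) show False by (auto simp: vec_eq_iff forall_3)
qed

text \<open>The left-hand side is the product of \<open>a\<close> with \<open>[u,a,b] (c - a) - [u,a,c] (b - a)\<close>. By Cramer's rule this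
vector is \<open>[a,b,c] u - [u, b - a, c - a] a\<close>, and the last determinant is \<open>\<langle>u,u\<rangle> [a,b,c]\<close> since both
differences are orthogonal to \<open>u\<close>. For the half-angle vectors with base \<open>a\<close>, this makes the
cross product at \<open>b\<close> and \<open>c\<close> a positive multiple of the determinant that decides on which side of a line a vertex lies.\<close>

lemma det3_affine:
  assumes "mink u a = 1" "mink u b = 1" "mink u c = 1" "mink a a = 1"
  shows "det3 u a b * (mink a c - 1) - det3 u a c * (mink a b - 1) = (1 - mink u u) * det3 a b c"
  using assms unfolding det3_expand mink_def by algebra

section \<open>Half-angle vectors of points on a circle\<close>

text \<open>The vector \<open>u\<close> may have any causal type; that \<open>\<langle>u,u\<rangle> < 1\<close>, which is needed for the scaling of \<open>x\<close>, follows
from the presence of two distinct points. Everything is read off from the Gram determinants of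
\<open>u\<close>, \<open>z 0\<close>, \<open>z j\<close>, \<open>z k\<close>. At the base vertex the quotient that defines \<open>x\<close> is \<open>0 / 0\<close>, and the value there is \<open>1\<close>.\<close>

lemma half_angle_arc_of_cocyclic:
  assumes unit: "\<And>j. j \<le> m \<Longrightarrow> mink (z j) (z j) = 1" "\<And>j. j \<le> m \<Longrightarrow> z j $ 1 > 0"
    and plane: "\<And>j. j \<le> m \<Longrightarrow> mink u (z j) = 1"
    and convex: "\<And>j. 0 < j \<Longrightarrow> j < m \<Longrightarrow> det3 (z j) (z (Suc j)) (z 0) > 0"
    and "m \<ge> 2"
  obtains \<kappa> x y where "half_angle_arc \<kappa> m x y"
    and "\<And>j k. j \<le> m \<Longrightarrow> k \<le> m \<Longrightarrow> (cross x y j k)\<^sup>2 = (mink (z j) (z k) - 1) / 2"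
proof -
  define U where "U = mink u u"
  define y where "y j = sqrt ((mink (z 0) (z j) - 1) / 2)" for j
  have plane': "mink (z j) u = 1" if "j \<le> m" for j
    using plane[OF that] by (simp add: mink_commute)
  define S where "S j = det3 u (z 0) (z j)" for j
  have ne: "z 0 \<noteq> z j" if "0 < j" "j \<le> m" for j
  proof (cases "j < m")
    case True
    with convex[of j] that show ?thesis by (auto simp: det3_expand algebra_simps)
  next
    case False
    then have "det3 (z (j - 1)) (z j) (z 0) > 0"
      using convex[of "j - 1"] that \<open>m \<ge> 2\<close> by auto
    then show ?thesis by (auto simp: det3_expand algebra_simps)
  qed
  have g: "mink (z 0) (z j) > 1" if "0 < j" "j \<le> m" for j
    using ne[OF that] that unit by (intro mink_unit_gt_1) auto
  have y2: "2 * (y j)\<^sup>2 = mink (z 0) (z j) - 1" if "j \<le> m" for j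
  proof (cases "j = 0")
    case False
    then have "mink (z 0) (z j) > 1" using g that by simp
    then show ?thesis by (simp add: y_def)
  qed (simp add: y_def unit)
  have y_pos: "y j > 0" if "0 < j" "j \<le> m" for j
    using g[OF that] by (simp add: y_def)
  have S2: "(S j)\<^sup>2 = 4 * (y j)\<^sup>2 * (1 - U - U * (y j)\<^sup>2)" if "j \<le> m" for j
  proof -
    \<comment> \<open>the Gram determinant of \<open>u, z 0, z j\<close>\<close>
    have "(S j)\<^sup>2 = (mink (z 0) (z j) - 1) * (2 - U * (1 + mink (z 0) (z j)))"
      using unit(1)[of 0] unit(1)[of j] plane[of 0] plane[of j] plane'[of 0] plane'[of j] that
      unfolding S_def power2_eq_square det3_mult_det3 U_def
      by (simp add: mink_commute[of "z j" "z 0"] algebra_simps)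
    moreover have "mink (z 0) (z j) = 1 + 2 * (y j)\<^sup>2"
      using y2[OF that] by simp
    ultimately show ?thesis by (simp add: algebra_simps)
  qed
  have U: "U < 1"
  proof (rule ccontr)
    assume "\<not> U < 1"
    then have "U * (y 1)\<^sup>2 > 0" "1 - U \<le> 0"
      using y_pos[of 1] \<open>m \<ge> 2\<close> by auto
    then have "1 - U - U * (y 1)\<^sup>2 < 0" by linarith
    then have "4 * (y 1)\<^sup>2 * (1 - U - U * (y 1)\<^sup>2) < 0"
      using y_pos[of 1] \<open>m \<ge> 2\<close> by (intro mult_pos_neg) auto
    then have "(S 1)\<^sup>2 < 0" using S2[of 1] \<open>m \<ge> 2\<close> by simp
    then show False by simp
  qed
  define D where "D = sqrt (1 - U)"
  have D: "D > 0" "D\<^sup>2 = 1 - U" using U by (auto simp: D_def)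
  define \<kappa> where "\<kappa> = U / (1 - U)"
  define x where "x j = (if j = 0 then 1 else S j / (2 * D * y j))" for j
  have y0: "y 0 = 0" using unit(1)[of 0] by (simp add: y_def)
  have cross: "cross x y j k = D * det3 (z 0) (z j) (z k) / (4 * y j * y k)"
    if "0 < j" "0 < k" "j \<le> m" "k \<le> m" for j k
  proof -
    have "S j * (2 * (y k)\<^sup>2) - S k * (2 * (y j)\<^sup>2) = D\<^sup>2 * det3 (z 0) (z j) (z k)"
      unfolding D(2) y2[OF that(3)] y2[OF that(4)] S_def U_def
      using unit(1)[of 0] plane that by (intro det3_affine) auto
    then have T: "D\<^sup>2 * det3 (z 0) (z j) (z k) = 2 * (S j * (y k)\<^sup>2 - S k * (y j)\<^sup>2)"
      by simp
    have "cross x y j k = 2 * (S j * (y k)\<^sup>2 - S k * (y j)\<^sup>2) / (4 * D * y j * y k)"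
      using D(1) y_pos[of j] y_pos[of k] that
      by (simp add: cross_def x_def divide_simps) (simp add: algebra_simps power2_eq_square)
    also have "\<dots> = D * det3 (z 0) (z j) (z k) / (4 * y j * y k)"
      unfolding T[symmetric] using D(1) by (simp add: power2_eq_square)
    finally show ?thesis .
  qed
  have cross2: "(cross x y j k)\<^sup>2 = (mink (z j) (z k) - 1) / 2" if "j \<le> m" "k \<le> m" for j k
  proof (cases "j = 0 \<or> k = 0")
    case True
    then show ?thesis
      using y2[of j] y2[of k] that unit(1)[of 0]
      by (auto simp: cross_def x_def y0 mink_commute[of "z j" "z 0"])
  next
    case False
    define T where "T = det3 (z 0) (z j) (z k)"
    let ?a = "mink (z 0) (z j)" and ?b = "mink (z 0) (z k)" and ?c = "mink (z j) (z k)"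
    \<comment> \<open>Each product is linear in \<open>?c\<close>: they are the laws of cosines for two angles of the triangle\<close>
    have "T * S j = (?a - 1) * (?c + ?b - 1 - ?a)" "T * S k = - ((?b - 1) * (?c + ?a - 1 - ?b))"
      using unit(1)[of 0] unit(1)[of j] unit(1)[of k] plane'[of 0] plane'[of j] plane'[of k] that
      unfolding S_def T_def det3_mult_det3
      by (simp_all add: mink_commute[of "z j" "z 0"]
          mink_commute[of "z k" "z 0"] mink_commute[of "z k" "z j"] algebra_simps)
    moreover have "S j * (?b - 1) - S k * (?a - 1) = D\<^sup>2 * T"
      unfolding D(2) S_def U_def T_def
      using unit(1)[of 0] plane that by (intro det3_affine) auto
    ultimately have "D\<^sup>2 * T\<^sup>2 = 2 * (?a - 1) * (?b - 1) * (?c - 1)"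
      by algebra
    also have "\<dots> = (4 * y j * y k)\<^sup>2 * ((?c - 1) / 2)"
      unfolding y2[OF that(1), symmetric] y2[OF that(2), symmetric]
      by (simp add: power_mult_distrib)
    finally show ?thesis
      using cross[of j k] y_pos[of j] y_pos[of k] that False
      by (simp add: T_def power_divide power_mult_distrib)
  qed
  have "half_angle_arc \<kappa> m x y"
    unfolding half_angle_arc_def
  proof (intro conjI allI impI)
    fix j assume j: "j \<le> m"
    show "(x j)\<^sup>2 + \<kappa> * (y j)\<^sup>2 = 1"
    proof (cases "j = 0")
      case False
      then have "y j > 0" using y_pos j by simp
      have cancel: "4 * b * e / (4 * d * b) = e / d" if "b \<noteq> 0" for b d e :: real
        using that by simp
      have "(x j)\<^sup>2 = (S j)\<^sup>2 / (4 * D\<^sup>2 * (y j)\<^sup>2)"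
        using False by (simp add: x_def power_divide power_mult_distrib)
      also have "\<dots> = (1 - U - U * (y j)\<^sup>2) / (1 - U)"
        unfolding S2[OF j] D(2) using \<open>y j > 0\<close> by (intro cancel) simp
      finally have "(x j)\<^sup>2 = (1 - U - U * (y j)\<^sup>2) / (1 - U)" .
      then show ?thesis
        using U by (simp add: \<kappa>_def field_simps)
    qed (simp add: x_def y0)
  next
    fix j assume j: "j < m"
    show "cross x y j (Suc j) > 0"
    proof (cases "j = 0")
      case True
      then show ?thesis using y_pos[of 1] \<open>m \<ge> 2\<close> by (simp add: cross_def x_def y0)
    next
      case False
      then have "det3 (z 0) (z j) (z (Suc j)) > 0"
        using convex[of j] j by (simp add: det3_expand algebra_simps)
      then show ?thesis
        using False j D y_pos[of j] y_pos[of "Suc j"] by (simp add: cross)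
    qed
  qed (use y_pos y0 in \<open>auto simp: x_def\<close>)
  with cross2 show ?thesis using that by blast
qed

section \<open>Motions from Lorentz transformations\<close>

definition projective_map :: "real^3^3 \<Rightarrow> real^2 \<Rightarrow> real^2" where
  "projective_map A X =
     (let v = A *v point_vec X in vector [v $ 2 / v $ 1, v $ 3 / v $ 1])"

lemma normalized_vec_unique:
  assumes "mink v v = 1" "represents v X"
  shows "X \<in> hyp_plane" "normalized_vec X = v"
proof -
  have v: "v = v $ 1 *\<^sub>R point_vec X" "v $ 1 > 0"
    using assms(2) represents_scale by (auto simp: represents_def)
  have 1: "(v $ 1)\<^sup>2 * mink (point_vec X) (point_vec X) = 1"
    using assms(1) v mink_scale by (metis power2_eq_square)
  then have "mink (point_vec X) (point_vec X) > 0"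
    by (smt (verit) mult_nonneg_nonpos zero_le_power2)
  then show "X \<in> hyp_plane"
    by (simp add: mink_point_vec hyp_plane_def power2_eq_square)
  have "v $ 1 * mink_norm (point_vec X) = mink_norm v"
    using v mink_norm_scale by metis
  then have "v $ 1 * mink_norm (point_vec X) = 1"
    using assms(1) by (simp add: mink_norm_def)
  then have "1 / mink_norm (point_vec X) = v $ 1"
    by (metis nonzero_eq_divide_eq mult_zero_right zero_neq_one)
  then show "normalized_vec X = v"
    using v(1) by (simp add: normalized_vec_def)
qed

lemma hyp_dist_normalized:
  "hyp_dist X Y = arcosh (mink (normalized_vec X) (normalized_vec Y))"
  by (simp add: hyp_dist_def normalized_vec_def mink_scale)

lemma represents_projective_map:
  assumes "represents x X" "(A *v x) $ 1 > 0"
  shows "represents (A *v x) (projective_map A X)"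
proof -
  have x: "x = x $ 1 *\<^sub>R point_vec X" "x $ 1 > 0"
    using assms(1) represents_scale by (auto simp: represents_def)
  then have "A *v x = x $ 1 *\<^sub>R (A *v point_vec X)"
    by (metis matrix_vector_mult_scaleR)
  then have "(A *v x) $ i = x $ 1 * (A *v point_vec X) $ i" for i
    by simp
  then show ?thesis
    using assms(2) x(2) by (simp add: represents_def projective_map_def Let_def)
qed

lemma represents_unique: "represents x X \<Longrightarrow> represents x Y \<Longrightarrow> X = Y"
  by (simp add: represents_def vec_eq_iff forall_2)

text \<open>The orthochronous Lorentz transformations, of either determinant: they induce the isometries of the
Klein model, and the sign of the determinant decides on the orientation.\<close>

definition lorentz :: "real^3^3 \<Rightarrow> bool" where
  "lorentz A \<longleftrightarrow> (\<forall>x y. mink (A *v x) (A *v y) = mink x y) \<and>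
     (\<forall>x. mink x x > 0 \<longrightarrow> x $ 1 > 0 \<longrightarrow> (A *v x) $ 1 > 0)"

text \<open>An isometry of the form permutes the two halves of the timelike cone, so one vector decides whether it
preserves the future half.\<close>

lemma lorentzI:
  assumes isom: "\<And>x y. mink (A *v x) (A *v y) = mink x y"
    and z: "mink z z > 0" "z $ 1 > 0" "(A *v z) $ 1 > 0"
  shows "lorentz A"
  unfolding lorentz_def
proof (intro conjI allI impI)
  fix x assume "mink x x > 0" "x $ 1 > 0"
  then have "mink z x > 0" using z by (simp add: timelike_mink_pos_iff)
  then show "(A *v x) $ 1 > 0"
    using timelike_mink_pos_iff[of "A *v z" "A *v x"] isom z \<open>mink x x > 0\<close> by simp
qed (rule isom)

lemma lorentz_projective_map:
  assumes "lorentz A" "X \<in> hyp_plane"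
  shows "projective_map A X \<in> hyp_plane"
    and "normalized_vec (projective_map A X) = A *v normalized_vec X"
proof -
  have x: "represents (normalized_vec X) X" "mink (normalized_vec X) (normalized_vec X) = 1"
    using normalized_vec[OF assms(2)] by auto
  then have "(A *v normalized_vec X) $ 1 > 0"
    using assms(1) by (auto simp: lorentz_def represents_def)
  then have rep: "represents (A *v normalized_vec X) (projective_map A X)"
    using represents_projective_map[OF x(1)] by simp
  have unit: "mink (A *v normalized_vec X) (A *v normalized_vec X) = 1"
    using assms(1) x(2) by (simp add: lorentz_def)
  show "projective_map A X \<in> hyp_plane"
    "normalized_vec (projective_map A X) = A *v normalized_vec X"
    using normalized_vec_unique[OF unit rep] by simp_all
qed

lemma lorentz_inverse:
  assumes "lorentz A" "A ** B = mat 1"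
  shows "lorentz B"
proof -
  have AB: "A *v (B *v x) = x" for x
    using assms(2) by (simp add: matrix_vector_mul_assoc)
  have isom: "mink (B *v x) (B *v y) = mink x y" for x y
    using assms(1) AB by (metis lorentz_def)
  let ?e = "axis 1 1 :: real^3"
  have e: "mink ?e ?e > 0" "?e $ 1 > 0"
    by (auto simp: mink_def axis_def)
  have BA: "B *v (A *v x) = x" for x
    using assms(2) by (metis matrix_left_right_inverse matrix_vector_mul_assoc matrix_vector_mul_lid)
  show ?thesis
  proof (rule lorentzI[OF isom, where z = "A *v ?e"])
  qed (use e assms(1) BA in \<open>auto simp: lorentz_def\<close>)
qed

text \<open>The map is a central projection after a linear map. The time component of the image
enters the Jacobian determinant with power \<open>-3\<close>, one more than the dimension of the plane.\<close>

lemma projective_map_jacobian: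
  assumes "(A *v point_vec X) $ 1 \<noteq> 0"
  obtains f' where "(projective_map A has_derivative f') (at X)"
    and "det (matrix f') = det A / ((A *v point_vec X) $ 1) ^ 3"
proof -
  define N where "N i X = A $ i $ 1 + A $ i $ 2 * X $ 1 + A $ i $ 3 * X $ 2" for i and X :: "real^2"
  define N' where "N' i h = A $ i $ 2 * h $ 1 + A $ i $ 3 * h $ 2" for i and h :: "real^2"
  have N: "(A *v point_vec X) $ i = N i X" for i X
    by (simp add: matrix_vector_mult_def sum_3 point_vec_def N_def)
  have N': "(N i has_derivative N' i) (at X)" for i
    unfolding N_def N'_def
    by (auto intro!: derivative_eq_intros bounded_linear.has_derivative[OF bounded_linear_vec_nth])
  have vec2: "(vector [a, b] :: real^2) = a *\<^sub>R axis 1 1 + b *\<^sub>R axis 2 1" for a b :: real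
    by (simp add: vec_eq_iff forall_2 axis_def)
  define q where "q i h = (N' i h * N 1 X - N i X * N' 1 h) / (N 1 X * N 1 X)" for i h
  define f' where "f' h = (vector [q 2 h, q 3 h] :: real^2)" for h
  have w: "N 1 X \<noteq> 0" using assms N by simp
  have q: "((\<lambda>X. N i X / N 1 X) has_derivative q i) (at X)" for i
    unfolding q_def using has_derivative_divide'[OF N' N' w] by (simp add: mult.commute)
  have "projective_map A = (\<lambda>X. vector [N 2 X / N 1 X, N 3 X / N 1 X])"
    by (simp add: projective_map_def N fun_eq_iff)
  then have "(projective_map A has_derivative f') (at X)"
    unfolding f'_def vec2
    by (auto intro!: derivative_intros q)
  moreover have "det (matrix f') = det A / N 1 X ^ 3"
  proof -
    have frac: "a / e\<^sup>2 * (d / e\<^sup>2) - b / e\<^sup>2 * (c / e\<^sup>2) = (a * d - b * c) / e ^ 4"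
      for a b c d e :: real
      by (simp add: diff_divide_distrib flip: power_add)
    have q_axis: "q i (axis 1 1) = (A $ i $ 2 * N 1 X - N i X * A $ 1 $ 2) / (N 1 X)\<^sup>2"
      "q i (axis 2 1) = (A $ i $ 3 * N 1 X - N i X * A $ 1 $ 3) / (N 1 X)\<^sup>2" for i
      by (simp_all add: q_def N'_def axis_def power2_eq_square)
    have "det (matrix f') = q 2 (axis 1 1) * q 3 (axis 2 1) - q 2 (axis 2 1) * q 3 (axis 1 1)"
      by (simp add: det_2 matrix_def f'_def)
    also have "\<dots> =
       ((A $ 2 $ 2 * N 1 X - N 2 X * A $ 1 $ 2) * (A $ 3 $ 3 * N 1 X - N 3 X * A $ 1 $ 3)
      - (A $ 2 $ 3 * N 1 X - N 2 X * A $ 1 $ 3) * (A $ 3 $ 2 * N 1 X - N 3 X * A $ 1 $ 2)) / (N 1 X) ^ 4"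
      unfolding q_axis by (rule frac)
    also have "\<dots> = det A * N 1 X / (N 1 X) ^ 4"
    proof -
      have "(A $ 2 $ 2 * N 1 X - N 2 X * A $ 1 $ 2) * (A $ 3 $ 3 * N 1 X - N 3 X * A $ 1 $ 3)
        - (A $ 2 $ 3 * N 1 X - N 2 X * A $ 1 $ 3) * (A $ 3 $ 2 * N 1 X - N 3 X * A $ 1 $ 2)
        = det A * N 1 X"
        unfolding N_def det_3 by algebra
      then show ?thesis by simp
    qed
    also have "\<dots> = det A / N 1 X ^ 3"
      using w by (simp add: power4_eq_xxxx power3_eq_cube)
    finally show ?thesis .
  qed
  ultimately show ?thesis using that N by metis
qed

lemma hyp_motion_projective_map:
  assumes "lorentz A" "det A > 0"
  shows "hyp_motion (projective_map A)"
  unfolding hyp_motion_def hyp_isometry_def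
proof (intro conjI ballI)
  obtain B where B: "A ** B = mat 1" "B ** A = mat 1"
    using assms(2) invertible_det_nz[of A] by (auto simp: invertible_def)
  have "Y \<in> projective_map A ` hyp_plane" if Y: "Y \<in> hyp_plane" for Y
  proof
    have l: "lorentz B" using lorentz_inverse[OF assms(1) B(1)] .
    let ?X = "projective_map B Y"
    show X: "?X \<in> hyp_plane" using lorentz_projective_map[OF l Y] by simp
    have "normalized_vec (projective_map A ?X) = normalized_vec Y"
      using lorentz_projective_map[OF l Y] lorentz_projective_map[OF assms(1) X] B
      by (simp add: matrix_vector_mul_assoc)
    then show "Y = projective_map A ?X"
      using normalized_vec(1)[OF Y] normalized_vec(1)[OF lorentz_projective_map(1)[OF assms(1) X]]
      by (metis represents_unique)
  qed
  then show "projective_map A ` hyp_plane = hyp_plane"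
    using lorentz_projective_map(1)[OF assms(1)] by auto
next
  fix X Y assume "X \<in> hyp_plane" "Y \<in> hyp_plane"
  then show "hyp_dist (projective_map A X) (projective_map A Y) = hyp_dist X Y"
    using lorentz_projective_map(2)[OF assms(1)] assms(1)
    unfolding hyp_dist_normalized lorentz_def by simp
next
  show "orientation_preserving (projective_map A)"
    unfolding orientation_preserving_def
  proof
    fix X assume X: "X \<in> hyp_plane"
    have "mink (point_vec X) (point_vec X) > 0"
      using X by (simp add: mink_point_vec hyp_plane_def power2_eq_square)
    moreover have "point_vec X $ 1 > 0"
      by (simp add: point_vec_def)
    ultimately have w: "(A *v point_vec X) $ 1 > 0"
      using assms(1) by (simp add: lorentz_def)
    then obtain f' where f': "(projective_map A has_derivative f') (at X)"
      "det (matrix f') = det A / ((A *v point_vec X) $ 1) ^ 3"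
      using projective_map_jacobian[of A X] by auto
    then show "\<exists>f'. (projective_map A has_derivative f') (at X) \<and> det (matrix f') > 0"
      using w assms(2) by auto
  qed
qed

definition columns3 :: "real^3 \<Rightarrow> real^3 \<Rightarrow> real^3 \<Rightarrow> real^3^3" where
  "columns3 a b c = transpose (vector [a, b, c])"

lemma det_columns3: "det (columns3 a b c) = det3 a b c"
  by (simp add: columns3_def det3_def)

lemma columns3_mult:
  "columns3 a b c *v t = t $ 1 *\<^sub>R a + t $ 2 *\<^sub>R b + t $ 3 *\<^sub>R c"
  by (simp add: columns3_def vec_eq_iff forall_3 matrix_vector_mult_def transpose_def sum_3 mult.commute)

lemma mink_add: "mink (x + y) v = mink x v + mink y v" "mink v (x + y) = mink v x + mink v y"
  by (auto simp: mink_def algebra_simps)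

lemma mink_scaleR: "mink (r *\<^sub>R x) v = r * mink x v" "mink v (r *\<^sub>R x) = r * mink v x"
  by (auto simp: mink_def algebra_simps)

lemma columns3_preimage:
  assumes "det3 a b c \<noteq> 0"
  obtains t where "v = columns3 a b c *v t"
proof -
  obtain B where "columns3 a b c ** B = mat 1"
    using assms invertible_det_nz[of "columns3 a b c"] det_columns3[of a b c]
    by (auto simp: invertible_def)
  then have "v = columns3 a b c *v (B *v v)"
    by (simp add: matrix_vector_mul_assoc)
  then show ?thesis using that by blast
qed

lemma mink_eqI:
  assumes "det3 a b c \<noteq> 0" "mink v a = mink w a" "mink v b = mink w b" "mink v c = mink w c"
  shows "v = w"
proof -
  have "mink v y = mink w y" for y
  proof -
    obtain t where "y = columns3 a b c *v t" using columns3_preimage[OF assms(1)] by blast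
    then show ?thesis using assms by (simp add: columns3_mult mink_add mink_scaleR)
  qed
  from this[of "axis 1 1"] this[of "axis 2 1"] this[of "axis 3 1"] show ?thesis
    by (simp add: mink_def axis_def vec_eq_iff forall_3)
qed

text \<open>The linear map is fixed by the first three vectors, which form a basis. It sends each further
\<open>z j\<close> to \<open>w j\<close> because both images have the same products with the basis \<open>w 0, w 1, w 2\<close>. Its determinant
is the quotient of those of the two bases.\<close>

lemma lorentz_of_gram:
  fixes z w :: "nat \<Rightarrow> real^3" and m :: nat
  assumes unit: "\<And>j. j \<le> m \<Longrightarrow> mink (z j) (z j) = 1" "\<And>j. j \<le> m \<Longrightarrow> z j $ 1 > 0"
      "\<And>j. j \<le> m \<Longrightarrow> w j $ 1 > 0"
    and gram: "\<And>j k. j \<le> m \<Longrightarrow> k \<le> m \<Longrightarrow> mink (w j) (w k) = mink (z j) (z k)"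
    and "m \<ge> 2" and det: "det3 (z 0) (z 1) (z 2) > 0" "det3 (w 0) (w 1) (w 2) > 0"
  obtains A where "lorentz A" "det A > 0" "\<And>j. j \<le> m \<Longrightarrow> A *v z j = w j"
proof -
  define Mz Mw where "Mz = columns3 (z 0) (z 1) (z 2)" and "Mw = columns3 (w 0) (w 1) (w 2)"
  have "invertible Mz"
    using det by (simp add: invertible_det_nz Mz_def det_columns3)
  then obtain B where B: "B ** Mz = mat 1"
    by (auto simp: invertible_def)
  define A where "A = Mw ** B"
  have A: "A *v (Mz *v t) = Mw *v t" for t
    unfolding A_def by (metis B matrix_vector_mul_assoc matrix_vector_mul_lid)
  have isom: "mink (A *v x) (A *v y) = mink x y" for x y
  proof -
    obtain s t where "x = Mz *v s" "y = Mz *v t"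
      using columns3_preimage[of "z 0" "z 1" "z 2"] det unfolding Mz_def by (metis less_irrefl)
    moreover have "mink (Mw *v s) (Mw *v t) = mink (Mz *v s) (Mz *v t)"
      using gram \<open>m \<ge> 2\<close> by (simp add: Mz_def Mw_def columns3_mult mink_add mink_scaleR)
    ultimately show ?thesis by (simp add: A)
  qed
  have basis: "A *v z 0 = w 0" "A *v z 1 = w 1" "A *v z 2 = w 2"
    using A[of "axis 1 1"] A[of "axis 2 1"] A[of "axis 3 1"]
    by (simp_all add: Mz_def Mw_def columns3_mult axis_def)
  have map: "A *v z j = w j" if "j \<le> m" for j
  proof (rule mink_eqI[of "w 0" "w 1" "w 2"])
    show "mink (A *v z j) (w 0) = mink (w j) (w 0)"
      using isom[of "z j" "z 0"] basis gram[of j 0] that \<open>m \<ge> 2\<close> by simp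
    show "mink (A *v z j) (w 1) = mink (w j) (w 1)"
      using isom[of "z j" "z 1"] basis gram[of j 1] that \<open>m \<ge> 2\<close> by simp
    show "mink (A *v z j) (w 2) = mink (w j) (w 2)"
      using isom[of "z j" "z 2"] basis gram[of j 2] that \<open>m \<ge> 2\<close> by simp
  qed (use det in simp)
  have "lorentz A"
    using lorentzI[OF isom, of "z 0"] unit basis by simp
  moreover have "det A > 0"
  proof -
    have "det B * det Mz = 1"
      using B by (metis det_I det_mul)
    then have "det A * det Mz = det Mw"
      by (simp add: A_def det_mul)
    then show ?thesis
      using det unfolding Mz_def Mw_def det_columns3 by (metis zero_less_mult_pos2)
  qed
  ultimately show ?thesis using that map by blast
qed

section \<open>Polygons whose closing side is longest\<close>

lemma det3_normalized_vec_pos_iff: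
  assumes "X \<in> hyp_plane" "Y \<in> hyp_plane" "V \<in> hyp_plane"
  shows "det3 (normalized_vec X) (normalized_vec Y) (normalized_vec V) > 0 \<longleftrightarrow>
    det3 (point_vec X) (point_vec Y) (point_vec V) > 0"
  using assms by (intro det3_point_vec_pos_iff normalized_vec)

text \<open>All three types of circles become one after division by the nonzero constant \<open>p\<close>.\<close>

lemma cocyclic_plane:
  assumes "cocyclic Z"
  obtains u where "\<And>X. X \<in> set Z \<Longrightarrow> mink u (normalized_vec X) = 1"
proof -
  obtain u p where "p \<noteq> 0" "set Z \<subseteq> circle_set u p"
  proof -
    obtain C where C: "set Z \<subseteq> C" "hyp_circle C" using assms by (auto simp: cocyclic_def)
    have nonneg: "mink_norm v \<ge> 0" for v by (simp add: mink_norm_def)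
    from C(2) show ?thesis
      unfolding hyp_circle_def distance_circle_def distance_line_def horocycle_def
      using C(1) nonneg that by (metis order.strict_iff_not order.trans)
  qed
  then have "mink ((1 / p) *\<^sub>R u) (normalized_vec X) = 1" if "X \<in> set Z" for X
    using that by (auto simp: circle_set_def mink_scaleR)
  then show ?thesis using that by blast
qed

lemma mink_of_hyp_dist:
  assumes "X \<in> hyp_plane" "Y \<in> hyp_plane"
  shows "mink (normalized_vec X) (normalized_vec Y) = cosh (hyp_dist X Y)"
  using cosh_hyp_dist[OF assms normalized_vec(1)[OF assms(1)] normalized_vec(1)[OF assms(2)]]
    normalized_vec(2)[OF assms(1)] normalized_vec(2)[OF assms(2)]
  by (simp add: mink_norm_def)

lemma oriented_convex_normalized:
  assumes "oriented_convex Z" "set Z \<subseteq> hyp_plane"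
    and "Suc k < length Z" "j < length Z" "j \<noteq> k" "j \<noteq> Suc k"
  shows "det3 (normalized_vec (Z ! k)) (normalized_vec (Z ! Suc k)) (normalized_vec (Z ! j)) > 0"
proof -
  have "Suc k mod length Z = Suc k" "k < length Z"
    using assms by auto
  then have "det3 (point_vec (Z ! k)) (point_vec (Z ! Suc k)) (point_vec (Z ! j)) > 0"
    using assms unfolding oriented_convex_def by metis
  moreover have "Z ! k \<in> hyp_plane" "Z ! Suc k \<in> hyp_plane" "Z ! j \<in> hyp_plane"
    using assms by auto
  ultimately show ?thesis
    by (simp add: det3_normalized_vec_pos_iff)
qed

text \<open>Convexity puts the base vertex to the left of every side that does not contain it, which is to
say that the half-angle vectors turn counterclockwise.\<close>

lemma polygon_half_angle_arc:
  assumes poly: "polygon (Suc m) Z" and conv: "oriented_convex Z" and circ: "cocyclic Z"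
  defines "v \<equiv> \<lambda>j. normalized_vec (Z ! j)"
  obtains \<kappa> x y where "half_angle_arc \<kappa> m x y"
    and "\<And>j k. j \<le> m \<Longrightarrow> k \<le> m \<Longrightarrow> (cross x y j k)\<^sup>2 = (mink (v j) (v k) - 1) / 2"
proof -
  have len: "length Z = Suc m" "m \<ge> 2" and plane: "j \<le> m \<Longrightarrow> Z ! j \<in> hyp_plane" for j
    using poly by (auto simp: polygon_def)
  obtain u where u: "\<And>X. X \<in> set Z \<Longrightarrow> mink u (normalized_vec X) = 1"
    using cocyclic_plane[OF circ] by blast
  show ?thesis
  proof (rule half_angle_arc_of_cocyclic[where m = m and z = v and u = u])
    fix j assume "0 < j" "j < m"
    then show "det3 (v j) (v (Suc j)) (v 0) > 0"
      unfolding v_def using conv poly len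
      by (intro oriented_convex_normalized) (auto simp: polygon_def)
  next
    fix j assume j: "j \<le> m"
    show "mink (v j) (v j) = 1" "v j $ 1 > 0"
      unfolding v_def using normalized_vec[OF plane[OF j]] by (auto simp: represents_def)
    show "mink u (v j) = 1"
      unfolding v_def using u len j by simp
  qed (use that len in auto)
qed

lemma length_spectrum_nth:
  "k < length Z \<Longrightarrow> length_spectrum Z ! k = hyp_dist (Z ! k) (Z ! (Suc k mod length Z))"
  by (simp add: length_spectrum_def)

lemma length_length_spectrum: "length (length_spectrum Z) = length Z"
  by (simp add: length_spectrum_def)

text \<open>The sides of both arcs are determined by the length spectrum, since cross products of consecutive vectors
are positive. Uniqueness of the arc then gives all the diagonals, that is, the Gram matrix.\<close>

lemma motion_of_longest_last:
  assumes Z: "polygon (Suc m) Z" "oriented_convex Z" "cocyclic Z"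
    and W: "polygon (Suc m) W" "oriented_convex W" "cocyclic W"
    and spec: "length_spectrum Z = length_spectrum W"
    and longest: "\<And>k. k \<le> m \<Longrightarrow> length_spectrum Z ! k \<le> length_spectrum Z ! m"
  obtains f where "hyp_motion f" "map f Z = W"
proof -
  define z w where "z j = normalized_vec (Z ! j)" and "w j = normalized_vec (W ! j)" for j
  have len: "length Z = Suc m" "length W = Suc m" "m \<ge> 2"
    and plane: "j \<le> m \<Longrightarrow> Z ! j \<in> hyp_plane" "j \<le> m \<Longrightarrow> W ! j \<in> hyp_plane" for j
    using Z(1) W(1) by (auto simp: polygon_def)
  obtain \<kappa> x y where arc: "half_angle_arc \<kappa> m x y"
    and chord: "\<And>j k. j \<le> m \<Longrightarrow> k \<le> m \<Longrightarrow> (cross x y j k)\<^sup>2 = (mink (z j) (z k) - 1) / 2"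
    using polygon_half_angle_arc[OF Z] unfolding z_def by blast
  obtain \<kappa>' x' y' where arc': "half_angle_arc \<kappa>' m x' y'"
    and chord': "\<And>j k. j \<le> m \<Longrightarrow> k \<le> m \<Longrightarrow> (cross x' y' j k)\<^sup>2 = (mink (w j) (w k) - 1) / 2"
    using polygon_half_angle_arc[OF W] unfolding w_def by blast
  have side: "mink (z k) (z (Suc k mod Suc m)) = cosh (length_spectrum Z ! k)"
    "mink (w k) (w (Suc k mod Suc m)) = cosh (length_spectrum Z ! k)"
    "length_spectrum Z ! k \<ge> 0"
    if "k \<le> m" for k
  proof -
    have "Suc k mod Suc m \<le> m" using mod_less_divisor[of "Suc m" "Suc k"] by linarith
    then show "mink (z k) (z (Suc k mod Suc m)) = cosh (length_spectrum Z ! k)"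
      "mink (w k) (w (Suc k mod Suc m)) = cosh (length_spectrum Z ! k)"
      "length_spectrum Z ! k \<ge> 0"
      using that plane len length_spectrum_nth[of k Z] length_spectrum_nth[of k W]
      by (auto simp: z_def w_def mink_of_hyp_dist spec hyp_dist_nonneg)
  qed
  have cross_m: "cross x y 0 m = y m" "cross x' y' 0 m = y' m" "y m > 0" "y' m > 0"
    using arc arc' len(3) by (auto simp: half_angle_arc_def cross_def)
  have cosh_m: "mink (z 0) (z m) = cosh (length_spectrum Z ! m)"
    "mink (w 0) (w m) = cosh (length_spectrum Z ! m)"
    using side[of m] by (simp_all add: mink_commute)
  have "(y' m)\<^sup>2 = (y m)\<^sup>2"
    using chord[of 0 m] chord'[of 0 m] cosh_m cross_m(1,2) by simp
  then have same_m: "y' m = y m"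
    using cross_m(3,4) by (simp add: power2_eq_iff_nonneg)
  have cross_side: "(cross x y j (Suc j))\<^sup>2 = (cosh (length_spectrum Z ! j) - 1) / 2"
    "(cross x' y' j (Suc j))\<^sup>2 = (cosh (length_spectrum Z ! j) - 1) / 2"
    "cross x y j (Suc j) > 0" "cross x' y' j (Suc j) > 0" if "j < m" for j
    using that side[of j] chord[of j "Suc j"] chord'[of j "Suc j"] arc arc'
    by (auto simp: half_angle_arc_def)
  have same: "cross x' y' j (Suc j) = cross x y j (Suc j)" if "j < m" for j
  proof -
    have "(cross x' y' j (Suc j))\<^sup>2 = (cross x y j (Suc j))\<^sup>2"
      using cross_side(1,2)[OF that] by simp
    then show ?thesis
      using cross_side(3,4)[OF that] by (simp add: power2_eq_iff_nonneg)
  qed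
  have long: "cross x y j (Suc j) \<le> y m" if "j < m" for j
  proof -
    have "cosh (length_spectrum Z ! j) \<le> cosh (length_spectrum Z ! m)"
      using longest[of j] side(3)[of j] side(3)[of m] that by (simp add: cosh_real_nonneg_le_iff)
    then have "(cross x y j (Suc j))\<^sup>2 \<le> (y m)\<^sup>2"
      using cross_side(1)[OF that] chord[of 0 m] cosh_m cross_m by simp
    then show ?thesis
      by (rule power2_le_imp_le) (use cross_m(3) in simp)
  qed
  have xy: "x' j = x j" "y' j = y j" if "j \<le> m" for j
    using half_angle_arc_unique[OF arc arc' len(3) same same_m long that] by auto
  have gram: "mink (w j) (w k) = mink (z j) (z k)" if "j \<le> m" "k \<le> m" for j k
    using chord[OF that] chord'[OF that] xy that by (simp add: cross_def)
  have det: "det3 (z 0) (z 1) (z 2) > 0" "det3 (w 0) (w 1) (w 2) > 0"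
    unfolding z_def w_def
    using oriented_convex_normalized[OF Z(2), of 0 2] oriented_convex_normalized[OF W(2), of 0 2]
      Z(1) W(1) len by (simp_all add: polygon_def)
  obtain A where A: "lorentz A" "det A > 0" "\<And>j. j \<le> m \<Longrightarrow> A *v z j = w j"
  proof (rule lorentz_of_gram[of m z w])
    fix j assume j: "j \<le> m"
    show "mink (z j) (z j) = 1" "z j $ 1 > 0" "w j $ 1 > 0"
      unfolding z_def w_def using normalized_vec plane[OF j] by (auto simp: represents_def)
  qed (use gram len det that in auto)
  have "projective_map A (Z ! j) = W ! j" if "j \<le> m" for j
  proof -
    have "normalized_vec (projective_map A (Z ! j)) = normalized_vec (W ! j)"
      using lorentz_projective_map(2)[OF A(1) plane(1)[OF that]] A(3)[OF that]
      by (simp add: z_def w_def)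
    then show ?thesis
      using normalized_vec(1)[OF plane(2)[OF that]]
        normalized_vec(1)[OF lorentz_projective_map(1)[OF A(1) plane(1)[OF that]]]
      by (metis represents_unique)
  qed
  then have "map (projective_map A) Z = W"
    using len by (intro nth_equalityI) auto
  then show ?thesis
    using that hyp_motion_projective_map[OF A(1,2)] by blast
qed

section \<open>Cyclic renumbering\<close>

lemma length_spectrum_rotate: "length_spectrum (rotate r Z) = rotate r (length_spectrum Z)"
proof (induction r)
  case (Suc r)
  have "length_spectrum (rotate1 V) = rotate1 (length_spectrum V)" for V :: "(real^2) list"
  proof (rule nth_equalityI)
    fix k assume "k < length (length_spectrum (rotate1 V))"
    then have "k < length V" by (simp add: length_length_spectrum)
    moreover from this have "Suc k mod length V < length V"
      by (intro mod_less_divisor) linarith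
    ultimately show "length_spectrum (rotate1 V) ! k = rotate1 (length_spectrum V) ! k"
      by (simp add: length_spectrum_nth nth_rotate1 length_length_spectrum)
  qed (simp add: length_length_spectrum)
  with Suc show ?case by simp
qed simp

lemma polygon_rotate:
  assumes "polygon n Z" shows "polygon n (rotate r Z)"
proof (induction r)
  case (Suc r)
  have "polygon n (rotate1 V)" if "polygon n V" for V
    unfolding polygon_def
  proof (intro conjI allI impI)
    fix k assume "k < n"
    moreover from this have "Suc k mod n < n"
      by (intro mod_less_divisor) linarith
    ultimately show "rotate1 V ! k \<noteq> rotate1 V ! (Suc k mod n)"
      using that by (simp add: polygon_def nth_rotate1)
  qed (use that in \<open>auto simp: polygon_def\<close>)
  with Suc show ?case by simp
qed (simp add: assms)

lemma oriented_convex_rotate: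
  assumes "oriented_convex Z" shows "oriented_convex (rotate r Z)"
proof (induction r)
  case (Suc r)
  have "oriented_convex (rotate1 V)" if conv: "oriented_convex V" for V
    unfolding oriented_convex_def
  proof (intro allI impI)
    let ?n = "length V" and ?s = "\<lambda>k. Suc k mod length V"
    fix k j assume kj: "k < length (rotate1 V)" "j < length (rotate1 V)"
      "j \<noteq> k \<and> j \<noteq> Suc k mod length (rotate1 V)"
    have inj: "?s a \<noteq> ?s b" if "a < ?n" "b < ?n" "a \<noteq> b" for a b
      using that by (auto simp: mod_Suc split: if_splits)
    have "?n > 0" using kj(1) unfolding length_rotate1 by linarith
    then have s: "?s a < ?n" for a by (rule mod_less_divisor)
    have "det3 (point_vec (V ! ?s k)) (point_vec (V ! ?s (?s k))) (point_vec (V ! ?s j)) > 0"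
      using conv kj s inj[of j k] inj[of j "?s k"] unfolding oriented_convex_def by simp
    then show "det3 (point_vec (rotate1 V ! k)) (point_vec (rotate1 V ! (Suc k mod length (rotate1 V))))
        (point_vec (rotate1 V ! j)) > 0"
      using kj s by (simp add: nth_rotate1)
  qed
  with Suc show ?case by simp
qed (simp add: assms)

lemma cocyclic_rotate: "cocyclic Z \<Longrightarrow> cocyclic (rotate r Z)"
  by (simp add: cocyclic_def)

lemma rotate_back:
  obtains s where "rotate s (rotate r xs) = xs"
proof -
  let ?n = "length xs"
  \<comment> \<open>a multiple of the length that is at least \<open>r\<close>, so that the difference does not truncate\<close>
  have "rotate (?n * Suc r - r) (rotate r xs) = rotate (?n * Suc r) xs" if "xs \<noteq> []"
    using that by (cases ?n) (auto simp: rotate_rotate algebra_simps)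
  then have "rotate (?n * Suc r - r) (rotate r xs) = xs"
    by (cases "xs = []") (simp_all add: rotate_id)
  then show ?thesis using that by blast
qed

lemma rotate_longest_last:
  fixes xs :: "real list"
  assumes "length xs = Suc m"
  obtains r where "\<And>k. k \<le> m \<Longrightarrow> rotate r xs ! k \<le> rotate r xs ! m"
proof -
  have "Max (set xs) \<in> set xs"
    using assms by (intro Max_in) auto
  then obtain i where i: "i < Suc m" "xs ! i = Max (set xs)"
    using assms by (metis in_set_conv_nth)
  \<comment> \<open>rotating by \<open>i\<close> moves entry \<open>i\<close> to the front, one step more to the end\<close>
  have "rotate (Suc i) xs ! m = xs ! ((Suc i + m) mod Suc m)"
    using assms nth_rotate[of m xs "Suc i"] by simp
  also have "(Suc i + m) mod Suc m = i"
    using i(1) by (metis add_Suc_shift mod_add_self2 mod_less)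
  finally have last: "rotate (Suc i) xs ! m = Max (set xs)"
    using i by simp
  have "rotate (Suc i) xs ! k \<le> Max (set xs)" if "k \<le> m" for k
  proof -
    have "rotate (Suc i) xs ! k \<in> set (rotate (Suc i) xs)"
      using that assms by (intro nth_mem) simp
    then show ?thesis by simp
  qed
  then show ?thesis using that last by metis
qed

lemma length_spectrum_motion:
  assumes "hyp_motion f" "set Z \<subseteq> hyp_plane"
  shows "length_spectrum (map f Z) = length_spectrum Z"
proof (rule nth_equalityI)
  fix k assume "k < length (length_spectrum (map f Z))"
  then have k: "k < length Z" by (simp add: length_length_spectrum)
  then have s: "Suc k mod length Z < length Z" by (intro mod_less_divisor) linarith
  have "Z ! k \<in> hyp_plane" "Z ! (Suc k mod length Z) \<in> hyp_plane"
    using assms(2) nth_mem[OF k] nth_mem[OF s] by auto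
  then show "length_spectrum (map f Z) ! k = length_spectrum Z ! k"
    using assms(1) k s by (simp add: length_spectrum_nth hyp_motion_def hyp_isometry_def)
qed (simp add: length_length_spectrum)

theorem theorem4p13:
  fixes n :: nat and Z W :: "(real^2) list"
  assumes "n \<ge> 3"
    and "polygon n Z" and "oriented_convex Z" and "cocyclic Z"
    and "polygon n W" and "oriented_convex W" and "cocyclic W"
  shows "hyp_equivalent Z W \<longleftrightarrow> cyclic_eq (length_spectrum Z) (length_spectrum W)"
proof
  assume "hyp_equivalent Z W"
  then obtain f r where f: "hyp_motion f" "rotate r (map f Z) = W"
    by (auto simp: hyp_equivalent_def cyclic_eq_def)
  then have "length_spectrum W = rotate r (length_spectrum Z)"
    using length_spectrum_rotate length_spectrum_motion[of f Z] \<open>polygon n Z\<close>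
    by (metis polygon_def)
  then show "cyclic_eq (length_spectrum Z) (length_spectrum W)"
    by (auto simp: cyclic_eq_def)
next
  assume "cyclic_eq (length_spectrum Z) (length_spectrum W)"
  then obtain q where q: "rotate q (length_spectrum Z) = length_spectrum W"
    by (auto simp: cyclic_eq_def)
  obtain m where n: "n = Suc m" using \<open>n \<ge> 3\<close> by (cases n) auto
  have "length (length_spectrum W) = Suc m"
    using \<open>polygon n W\<close> n by (simp add: length_length_spectrum polygon_def)
  then obtain r where r: "\<And>k. k \<le> m \<Longrightarrow>
      rotate r (length_spectrum W) ! k \<le> rotate r (length_spectrum W) ! m"
    using rotate_longest_last by blast
  have spec: "length_spectrum (rotate r (rotate q Z)) = length_spectrum (rotate r W)"
    by (simp add: length_spectrum_rotate q)
  obtain f where f: "hyp_motion f" "map f (rotate r (rotate q Z)) = rotate r W"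
  proof (rule motion_of_longest_last[OF _ _ _ _ _ _ spec])
    fix k assume "k \<le> m"
    then show "length_spectrum (rotate r (rotate q Z)) ! k \<le> length_spectrum (rotate r (rotate q Z)) ! m"
      unfolding spec length_spectrum_rotate[of r W] by (rule r)
  qed (use assms n that in \<open>auto intro!: polygon_rotate oriented_convex_rotate cocyclic_rotate\<close>)
  obtain s where s: "rotate s (rotate r W) = W"
    using rotate_back by blast
  have "rotate (s + (r + q)) (map f Z) = rotate s (map f (rotate r (rotate q Z)))"
    by (simp add: rotate_map rotate_rotate)
  also have "\<dots> = W"
    by (simp only: f(2) s)
  finally have "rotate (s + (r + q)) (map f Z) = W" .
  then show "hyp_equivalent Z W"
    using f(1) by (auto simp: hyp_equivalent_def cyclic_eq_def)
qed

end
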